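(* Let $\precsim$ be a preorder on a topological space $(Y,\tau)$. Then the following assertions are equivalent: (1) $\precsim$ is $\tau$-continuous. (2) The topology $\tau$ is finer than the coarsest topology on $Y$ including both $\tau^{\precsim}_{U}$ and $\tau^{\precsim}_{L}$.
   Context: A preorder is a reflexive and transitive binary relation on a non-empty set. For a preorder $\precsim$ on $Y$ and $y\in Y$, the lower and upper contour sets are $L^{\precsim}(y)=\{x\in Y: x\precsim y\}$ and $U^{\precsim}(y)=\{x\in Y: y\precsim x\}$. The upper topology $\tau^{\precsim}_{U}$ is the topology on $Y$ generated by the subbase $\{Y\setminus L^{\precsim}(x)\}_{x\in Y}$; the lower topology $\tau^{\precsim}_{L}$ is the topology on $Y$ generated by the subbase $\{Y\setminus U^{\precsim}(x)\}_{x\in Y}$. A preorder $\precsim$ on a topological space $(Y,\tau)$ is $\tau$-continuous if for every $y\in Y$ both $L^{\precsim}(y)$ and $U^{\precsim}(y)$ are closed with respect to $\tau$. "$\tau$ is finer than $\tau'$" means $\tau'\subseteq\tau$ (equality allowed). *)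

theory Defs
  imports "HOL-Analysis.Analysis"
begin

definition lower_contour :: "'a set \<Rightarrow> ('a \<times> 'a) set \<Rightarrow> 'a \<Rightarrow> 'a set" where
  "lower_contour Y r y = {x \<in> Y. (x, y) \<in> r}"

definition upper_contour :: "'a set \<Rightarrow> ('a \<times> 'a) set \<Rightarrow> 'a \<Rightarrow> 'a set" where
  "upper_contour Y r y = {x \<in> Y. (y, x) \<in> r}"

text \<open>
  The empty intersection counts as \<open>Y\<close>, so the result is a topology on all of \<open>Y\<close> even if the
  subbase does not cover \<open>Y\<close>. The library's \<open>topology_generated_by \<S>\<close> is a topology on
  \<open>\<Union>\<S>\<close> only; for the subbases below that would lose every point that is below
  (respectively above) all others.
\<close>

definition subbase_topology :: "'a set \<Rightarrow> 'a set set \<Rightarrow> 'a topology" where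
  "subbase_topology Y \<S> =
     topology (arbitrary union_of (finite intersection_of (\<lambda>S. S \<in> \<S>) relative_to Y))"

definition upper_topology :: "'a set \<Rightarrow> ('a \<times> 'a) set \<Rightarrow> 'a topology" where
  "upper_topology Y r = subbase_topology Y {Y - lower_contour Y r x |x. x \<in> Y}"

definition lower_topology :: "'a set \<Rightarrow> ('a \<times> 'a) set \<Rightarrow> 'a topology" where
  "lower_topology Y r = subbase_topology Y {Y - upper_contour Y r x |x. x \<in> Y}"

definition continuous_preorder :: "'a topology \<Rightarrow> ('a \<times> 'a) set \<Rightarrow> bool" where
  "continuous_preorder \<tau> r \<longleftrightarrow>
     (\<forall>y \<in> topspace \<tau>. closedin \<tau> (lower_contour (topspace \<tau>) r y) \<and>
                      closedin \<tau> (upper_contour (topspace \<tau>) r y))"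

text \<open>\<open>finer \<tau> \<sigma>\<close>: both are topologies on the same set and \<open>\<sigma>\<close> is included in \<open>\<tau>\<close>.\<close>

definition finer :: "'a topology \<Rightarrow> 'a topology \<Rightarrow> bool" where
  "finer \<tau> \<sigma> \<longleftrightarrow> topspace \<tau> = topspace \<sigma> \<and> {U. openin \<sigma> U} \<subseteq> {U. openin \<tau> U}"

definition is_coarsest_including :: "'a topology \<Rightarrow> 'a topology \<Rightarrow> 'a topology \<Rightarrow> bool" where
  "is_coarsest_including \<sigma>1 \<sigma>2 \<rho> \<longleftrightarrow>
     finer \<rho> \<sigma>1 \<and> finer \<rho> \<sigma>2 \<and> (\<forall>\<rho>'. finer \<rho>' \<sigma>1 \<and> finer \<rho>' \<sigma>2 \<longrightarrow> finer \<rho>' \<rho>)"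

definition coarsest_including :: "'a topology \<Rightarrow> 'a topology \<Rightarrow> 'a topology" where
  "coarsest_including \<sigma>1 \<sigma>2 = (THE \<rho>. is_coarsest_including \<sigma>1 \<sigma>2 \<rho>)"

lemma openin_subbase_topology:
  "openin (subbase_topology Y \<S>) =
     arbitrary union_of (finite intersection_of (\<lambda>S. S \<in> \<S>) relative_to Y)"
  by (simp add: subbase_topology_def istopology_subbase)

lemma topspace_subbase_topology [simp]: "topspace (subbase_topology Y \<S>) = Y"
  unfolding subbase_topology_def by (rule topspace_subbase)

lemma topspace_upper_topology [simp]: "topspace (upper_topology Y r) = Y"
  by (simp add: upper_topology_def)

lemma topspace_lower_topology [simp]: "topspace (lower_topology Y r) = Y"
  by (simp add: lower_topology_def)

lemma openin_subbase_topology_Basis: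
  assumes "S \<in> \<S>" "S \<subseteq> Y"
  shows "openin (subbase_topology Y \<S>) S"
proof -
  have "(finite intersection_of (\<lambda>S. S \<in> \<S>)) S"
    using assms(1) by (simp add: finite_intersection_of_inc)
  then have "(finite intersection_of (\<lambda>S. S \<in> \<S>) relative_to Y) (Y \<inter> S)"
    by (rule relative_to_inc)
  moreover have "Y \<inter> S = S"
    using assms(2) by blast
  ultimately show ?thesis
    unfolding openin_subbase_topology by (simp add: arbitrary_union_of_inc)
qed

lemma finer_subbase_topology:
  assumes "\<And>S. S \<in> \<S> \<Longrightarrow> openin \<rho> S"
  shows "finer \<rho> (subbase_topology (topspace \<rho>) \<S>)"
proof -
  have "openin \<rho> U" if "openin (subbase_topology (topspace \<rho>) \<S>) U" for U
    using minimal_topology_subbase[of "\<lambda>S. S \<in> \<S>" \<rho> "topspace \<rho>" U] that assms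
    unfolding subbase_topology_def by blast
  then show ?thesis
    by (auto simp: finer_def)
qed

lemma finer_antisym: "finer \<rho> \<sigma> \<Longrightarrow> finer \<sigma> \<rho> \<Longrightarrow> \<rho> = \<sigma>"
  unfolding finer_def by (auto simp: topology_eq)

text \<open>The coarsest topology including two topologies on the same set exists and is unique.\<close>

lemma ex1_coarsest_including:
  assumes "topspace \<sigma>1 = topspace \<sigma>2"
  shows "\<exists>!\<rho>. is_coarsest_including \<sigma>1 \<sigma>2 \<rho>"
proof
  let ?S = "{U. openin \<sigma>1 U} \<union> {U. openin \<sigma>2 U}"
  let ?T = "subbase_topology (topspace \<sigma>1) ?S"
  have sub: "openin ?T U" if "U \<in> ?S" for U
    using that assms by (intro openin_subbase_topology_Basis) (auto dest: openin_subset)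
  have "finer \<rho>' ?T" if "finer \<rho>' \<sigma>1" "finer \<rho>' \<sigma>2" for \<rho>'
  proof -
    have "topspace \<rho>' = topspace \<sigma>1"
      using that(1) by (simp add: finer_def)
    moreover have "finer \<rho>' (subbase_topology (topspace \<rho>') ?S)"
      using that by (intro finer_subbase_topology) (auto simp: finer_def)
    ultimately show ?thesis by simp
  qed
  then show "is_coarsest_including \<sigma>1 \<sigma>2 ?T"
    unfolding is_coarsest_including_def using sub assms by (auto simp: finer_def)
  show "\<rho> = ?T" if "is_coarsest_including \<sigma>1 \<sigma>2 \<rho>" for \<rho>
    using that \<open>is_coarsest_including \<sigma>1 \<sigma>2 ?T\<close>
    unfolding is_coarsest_including_def by (blast intro: finer_antisym)
qed

lemma is_coarsest_including_coarsest_including: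
  "topspace \<sigma>1 = topspace \<sigma>2 \<Longrightarrow> is_coarsest_including \<sigma>1 \<sigma>2 (coarsest_including \<sigma>1 \<sigma>2)"
  unfolding coarsest_including_def by (rule theI') (rule ex1_coarsest_including)

end

theory Submission
  imports Defs
begin

text \<open>The sets that continuity requires to be open, the complements of the contour sets, are
  exactly the subbase members of the two order topologies. A topology on \<open>Y\<close> contains a
  generated topology iff it contains its subbase (\<open>finer_subbase_topology_iff\<close>), and
  contains the coarsest common refinement iff it contains both topologies
  (\<open>finer_coarsest_including_iff\<close>).\<close>

lemma finer_trans: "finer \<rho> \<sigma> \<Longrightarrow> finer \<sigma> \<upsilon> \<Longrightarrow> finer \<rho> \<upsilon>"
  by (auto simp: finer_def)

text \<open>Universal property of the join: transitivity gives one direction, minimality the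
  other.\<close>

lemma finer_coarsest_including_iff:
  assumes "topspace \<sigma>1 = topspace \<sigma>2"
  shows "finer \<rho> (coarsest_including \<sigma>1 \<sigma>2) \<longleftrightarrow> finer \<rho> \<sigma>1 \<and> finer \<rho> \<sigma>2"
  using is_coarsest_including_coarsest_including[OF assms]
  unfolding is_coarsest_including_def by (blast intro: finer_trans)

text \<open>Subbase members enter the generated topology intersected with the carrier; the inclusion
  assumption makes them open as they stand.\<close>

lemma finer_subbase_topology_iff:
  assumes "\<And>S. S \<in> \<S> \<Longrightarrow> S \<subseteq> topspace \<rho>"
  shows "finer \<rho> (subbase_topology (topspace \<rho>) \<S>) \<longleftrightarrow> (\<forall>S\<in>\<S>. openin \<rho> S)"
proof
  assume "finer \<rho> (subbase_topology (topspace \<rho>) \<S>)"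
  then show "\<forall>S\<in>\<S>. openin \<rho> S"
    using assms by (auto simp: finer_def intro: openin_subbase_topology_Basis)
qed (simp add: finer_subbase_topology)

text \<open>Contour sets lie in the carrier by definition, so closedness reduces to openness of the
  complement, a subbase member.\<close>

lemma finer_upper_topology_iff:
  "finer \<rho> (upper_topology (topspace \<rho>) r) \<longleftrightarrow>
     (\<forall>y\<in>topspace \<rho>. closedin \<rho> (lower_contour (topspace \<rho>) r y))"
  unfolding upper_topology_def
  by (subst finer_subbase_topology_iff) (auto simp: closedin_def lower_contour_def)

lemma finer_lower_topology_iff:
  "finer \<rho> (lower_topology (topspace \<rho>) r) \<longleftrightarrow>
     (\<forall>y\<in>topspace \<rho>. closedin \<rho> (upper_contour (topspace \<rho>) r y))"
  unfolding lower_topology_def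
  by (subst finer_subbase_topology_iff) (auto simp: closedin_def upper_contour_def)

theorem theorem1:
  fixes \<tau> :: "'a topology" and Y :: "'a set" and r :: "('a \<times> 'a) set"
  assumes "topspace \<tau> = Y" and "Y \<noteq> {}" and "preorder_on Y r"
  shows "continuous_preorder \<tau> r \<longleftrightarrow>
         finer \<tau> (coarsest_including (upper_topology Y r) (lower_topology Y r))"
  \<comment> \<open>Replacing \<open>Y\<close> by \<open>topspace \<tau>\<close> brings the goal
    into the form of the equivalences above.\<close>
  unfolding assms(1)[symmetric] continuous_preorder_def
  by (auto simp: finer_coarsest_including_iff finer_upper_topology_iff finer_lower_topology_iff)

end
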